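(* Let $\mathbf X\in\mathbb R^{n\times d}$ with $n\ge d$ have rank $d$, and let $\mathbf y\in\mathbb R^n$ be arbitrary. Let $S\subseteq\{1,\dots,n\}$ be a $d$-element set obtained by size $d$ volume sampling from $\mathbf X$, and let $\mathbf w^*(S)=(\mathbf X_S)^+\mathbf y_S$ be the optimal solution for the subproblem $(\mathbf X_S,\mathbf y_S)$. If $\mathbf X$ is in general position, then $$\mathbb E\big[L(\mathbf w^*(S))\big]=(d+1)\,L(\mathbf w^* ).$$ If $\mathbf X$ is not in general position, then $\mathbb E\big[L(\mathbf w^*(S))\big]\le (d+1)\,L(\mathbf w^* )$.
   Context: $\mathbf X_S$ is the submatrix of the rows of $\mathbf X$ indexed by $S$, and $\mathbf y_S$ the corresponding subvector of $\mathbf y$; $^+$ is the Moore–Penrose pseudoinverse. $L(\mathbf w)=\|\mathbf X\mathbf w-\mathbf y\|^2$ is the square loss on all $n$ rows, and $\mathbf w^*=\mathbf X^+\mathbf y=\operatorname{argmin}_{\mathbf w}L(\mathbf w)$. Size $d$ volume sampling from $\mathbf X$ selects a $d$-element set $S$ with probability $P(S)=\det(\mathbf X_S^\top\mathbf X_S)/\det(\mathbf X^\top\mathbf X)$. $\mathbf X$ is in general position if $\det(\mathbf X_S^\top\mathbf X_S)>0$ for every $d$-element set $S$. *)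

theory Defs
  imports
    "HOL-Probability.Probability_Mass_Function"
    "Jordan_Normal_Form.DL_Rank"
    "Jordan_Normal_Form.DL_Submatrix"
begin

text \<open>Rows, columns and vector entries are indexed from 0, so the row index set
  \<open>{1, \<dots>, n}\<close> becomes \<open>{..<n}\<close>. Both \<open>row_submatrix\<close> and \<open>subvector\<close> keep the selected
  entries in increasing order of their indices.\<close>

definition row_submatrix :: "real mat \<Rightarrow> nat set \<Rightarrow> real mat" where
  "row_submatrix X S = submatrix X S {..<dim_col X}"

definition subvector :: "real Matrix.vec \<Rightarrow> nat set \<Rightarrow> real Matrix.vec" where
  "subvector y S = Matrix.vec (card {i. i < dim_vec y \<and> i \<in> S}) (\<lambda>i. vec_index y (pick S i))"

text \<open>The four Penrose conditions; over the reals the adjoint is the transpose.\<close>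

definition is_moore_penrose :: "real mat \<Rightarrow> real mat \<Rightarrow> bool" where
  "is_moore_penrose A G \<longleftrightarrow>
     G \<in> carrier_mat (dim_col A) (dim_row A) \<and>
     A * G * A = A \<and>
     G * A * G = G \<and>
     transpose_mat (A * G) = A * G \<and>
     transpose_mat (G * A) = G * A"

definition pseudoinverse :: "real mat \<Rightarrow> real mat" where
  "pseudoinverse A = (THE G. is_moore_penrose A G)"

definition square_loss :: "real mat \<Rightarrow> real Matrix.vec \<Rightarrow> real Matrix.vec \<Rightarrow> real" where
  "square_loss X y w = scalar_prod (X *\<^sub>v w - y) (X *\<^sub>v w - y)"

definition lsq_solution :: "real mat \<Rightarrow> real Matrix.vec \<Rightarrow> real Matrix.vec" where
  "lsq_solution X y = pseudoinverse X *\<^sub>v y"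

definition gram_det :: "real mat \<Rightarrow> real" where
  "gram_det A = Determinant.det (transpose_mat A * A)"

text \<open>For \<open>X\<close> of full column rank, the weights are nonnegative and, by the Cauchy-Binet
  formula, sum to 1, so that \<open>embed_pmf\<close> yields the distribution with these probabilities;
  otherwise its value is unspecified.\<close>

definition volume_sampling :: "real mat \<Rightarrow> nat set pmf" where
  "volume_sampling X = embed_pmf (\<lambda>S.
     if S \<subseteq> {..<dim_row X} \<and> card S = dim_col X
     then gram_det (row_submatrix X S) / gram_det X else 0)"

definition general_position :: "real mat \<Rightarrow> bool" where
  "general_position X \<longleftrightarrow>
     (\<forall>S. S \<subseteq> {..<dim_row X} \<and> card S = dim_col X \<longrightarrow> gram_det (row_submatrix X S) > 0)"

end

theory Submission
  imports Defs
begin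

text \<open>For a \<open>d\<close>-set \<open>S\<close> with \<open>X\<^sub>S\<close> invertible, \<open>w = w\<^sup>*(S)\<close> interpolates \<open>y\<close> on \<open>S\<close>. Column
  operations therefore give
  \<open>det [X | y]\<^bsub>S,i\<^esub> = det X\<^sub>S \<cdot> (y\<^sub>i - x\<^sub>i \<cdot> w)\<close> for every row \<open>i\<close>, so that
  \<open>det (X\<^sub>S)\<^sup>2 L(w)\<close> is the sum over \<open>i\<close> of the squared maximal minors of \<open>[X | y]\<close> on \<open>S \<union> {i}\<close>;
  if \<open>X\<^sub>S\<close> is singular, the left side is 0 and only \<open>\<le>\<close> remains. Summing over \<open>S\<close> counts every
  \<open>(d+1)\<close>-set \<open>d+1\<close> times, and by Cauchy-Binet the total is
  \<open>(d+1) det ([X | y]\<^sup>T [X | y]) = (d+1) det (X\<^sup>T X) L(w\<^sup>*)\<close>.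

  Row sets are replaced by arbitrary maps \<open>f\<close> from \<open>{..<k}\<close> to the row indices: non-injective
  maps contribute 0, every \<open>k\<close>-set is hit \<open>k!\<close> times, and no ordering or sign has to be tracked.\<close>

section \<open>Row selection along a map\<close>

definition select_rows :: "nat \<Rightarrow> (nat \<Rightarrow> nat) \<Rightarrow> 'a mat \<Rightarrow> 'a mat" where
  "select_rows k f A = Matrix.mat k (dim_col A) (\<lambda>(i, j). A $$ (f i, j))"

lemma select_rows_dim [simp]:
  "dim_row (select_rows k f A) = k" "dim_col (select_rows k f A) = dim_col A"
  by (simp_all add: select_rows_def)

lemma select_rows_carrier [simp]:
  "A \<in> carrier_mat n d \<Longrightarrow> select_rows k f A \<in> carrier_mat k d"
  by (simp add: select_rows_def)

lemma select_rows_index [simp]: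
  "i < k \<Longrightarrow> j < dim_col A \<Longrightarrow> select_rows k f A $$ (i, j) = A $$ (f i, j)"
  by (simp add: select_rows_def)

lemma select_rows_mult:
  assumes "A \<in> carrier_mat n d" "B \<in> carrier_mat d m" "\<And>i. i < k \<Longrightarrow> f i < n"
  shows "select_rows k f (A * B) = select_rows k f A * B"
  by (rule eq_matI) (use assms in \<open>auto simp: scalar_prod_def\<close>)

lemma select_rows_mult_vec:
  assumes "A \<in> carrier_mat n d" "i < k" "f i < n"
  shows "(select_rows k f A *\<^sub>v v) $ i = (A *\<^sub>v v) $ f i"
proof -
  have "Matrix.row (select_rows k f A) i = Matrix.row A (f i)"
    using assms by (intro eq_vecI) auto
  then show ?thesis using assms by simp
qed

lemma det_select_rows_not_inj:
  fixes A :: "'a :: comm_ring_1 mat"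
  assumes "A \<in> carrier_mat n k" "\<not> inj_on f {..<k}"
  shows "Determinant.det (select_rows k f A) = 0"
proof -
  obtain i j where ij: "i < k" "j < k" "i \<noteq> j" "f i = f j"
    using assms(2) by (auto simp: inj_on_def)
  show ?thesis
    by (rule det_identical_rows[OF select_rows_carrier[OF assms(1)] ij(3,1,2)])
      (use ij assms(1) in \<open>auto intro!: eq_vecI\<close>)
qed

section \<open>The Cauchy-Binet formula for Gram determinants\<close>

text \<open>Each entry of the Gram matrix is a sum over rows, so multiplying out the Leibniz product
  amounts to choosing a row \<open>f i\<close> for every position \<open>i\<close>. With
  \<open>f\<close> fixed, the sum over permutations is again a Leibniz formula. The result is only
  half symmetric: one factor is still a diagonal product.\<close>

lemma det_gram_expand:
  fixes A :: "'a :: comm_ring_1 mat"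
  assumes A: "A \<in> carrier_mat n d"
  shows "Determinant.det (transpose_mat A * A) =
    (\<Sum>f\<in>{..<d} \<rightarrow>\<^sub>E {..<n}. (\<Prod>i<d. A $$ (f i, i)) * Determinant.det (select_rows d f A))"
proof -
  let ?P = "{p. p permutes {0..<d}}" and ?F = "{..<d} \<rightarrow>\<^sub>E {..<n}"
  have "Determinant.det (transpose_mat A * A) =
      (\<Sum>p\<in>?P. signof p * (\<Prod>i<d. (transpose_mat A * A) $$ (i, p i)))"
    using A by (subst det_def'[of _ d]) (auto simp: atLeast0LessThan)
  also have "\<dots> = (\<Sum>p\<in>?P. signof p * (\<Prod>i<d. \<Sum>k<n. A $$ (k, i) * A $$ (k, p i)))"
  proof (intro sum.cong refl arg_cong2[of _ _ _ _ "(*)"] prod.cong)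
    fix p i assume "p \<in> ?P" "i \<in> {..<d}"
    then have "p i < d" "i < d" using permutes_in_image[of p "{0..<d}" i] by auto
    then show "(transpose_mat A * A) $$ (i, p i) = (\<Sum>k<n. A $$ (k, i) * A $$ (k, p i))"
      using A by (auto simp: scalar_prod_def atLeast0LessThan intro!: sum.cong)
  qed
  also have "\<dots> = (\<Sum>p\<in>?P. signof p * (\<Sum>f\<in>?F. \<Prod>i<d. A $$ (f i, i) * A $$ (f i, p i)))"
    by (simp add: prod_sum_PiE)
  also have "\<dots> = (\<Sum>p\<in>?P. \<Sum>f\<in>?F. (\<Prod>i<d. A $$ (f i, i)) * (signof p * (\<Prod>i<d. A $$ (f i, p i))))"
    by (simp add: sum_distrib_left prod.distrib mult_ac)
  also have "\<dots> = (\<Sum>f\<in>?F. \<Sum>p\<in>?P. (\<Prod>i<d. A $$ (f i, i)) * (signof p * (\<Prod>i<d. A $$ (f i, p i))))"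
    by (rule sum.swap)
  also have "\<dots> = (\<Sum>f\<in>?F. (\<Prod>i<d. A $$ (f i, i)) * (\<Sum>p\<in>?P. signof p * (\<Prod>i<d. A $$ (f i, p i))))"
    by (simp add: sum_distrib_left)
  also have "\<dots> = (\<Sum>f\<in>?F. (\<Prod>i<d. A $$ (f i, i)) * Determinant.det (select_rows d f A))"
  proof (intro sum.cong refl arg_cong2[of _ _ _ _ "(*)"])
    fix f
    have "Determinant.det (select_rows d f A) =
        (\<Sum>p\<in>?P. signof p * (\<Prod>i=0..<d. select_rows d f A $$ (i, p i)))"
      using A by (intro det_def') auto
    also have "\<dots> = (\<Sum>p\<in>?P. signof p * (\<Prod>i<d. A $$ (f i, p i)))"
    proof (intro sum.cong refl arg_cong2[of _ _ _ _ "(*)"] prod.cong)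
      fix p i assume "p \<in> ?P" "i \<in> {..<d}"
      then have "p i < d" "i < d" using permutes_in_image[of p "{0..<d}" i] by auto
      then show "select_rows d f A $$ (i, p i) = A $$ (f i, p i)" using A by simp
    qed (auto)
    finally show "(\<Sum>p\<in>?P. signof p * (\<Prod>i<d. A $$ (f i, p i))) = Determinant.det (select_rows d f A)" ..
  qed
  finally show ?thesis .
qed

text \<open>A permutation of \<open>S\<close> fixes every point outside \<open>S\<close>, so
  precomposition with it preserves extensionality. This permits the reindexing of row choices in
  \<open>cauchy_binet_gram\<close>.\<close>

lemma bij_betw_PiE_permute:
  assumes p: "p permutes S"
  shows "bij_betw (\<lambda>f. f \<circ> p) (S \<rightarrow>\<^sub>E T) (S \<rightarrow>\<^sub>E T)"
proof (rule bij_betw_byWitness[where f' = "\<lambda>f. f \<circ> inv_into UNIV p"])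
  have *: "(\<lambda>f. f \<circ> q) ` (S \<rightarrow>\<^sub>E T) \<subseteq> S \<rightarrow>\<^sub>E T" if "q permutes S" for q
    using permutes_in_image[OF that] that
    by (auto simp: PiE_def extensional_def permutes_def)
  show "(\<lambda>f. f \<circ> p) ` (S \<rightarrow>\<^sub>E T) \<subseteq> S \<rightarrow>\<^sub>E T" "(\<lambda>f. f \<circ> inv_into UNIV p) ` (S \<rightarrow>\<^sub>E T) \<subseteq> S \<rightarrow>\<^sub>E T"
    using *[OF p] *[OF permutes_inv[OF p]] by auto
qed (auto simp: permutes_inv_o[OF p] comp_assoc)

text \<open>Reindexing \<open>det_gram_expand\<close> by a permutation \<open>p\<close> of the
  positions only brings out the sign of \<open>p\<close> from the determinant. Adding these
  expansions over all \<open>d!\<close> permutations turns the diagonal product into a second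
  determinant, hence the square.\<close>

lemma cauchy_binet_gram:
  fixes A :: "'a :: {comm_ring_1, semiring_char_0} mat"
  assumes A: "A \<in> carrier_mat n d"
  shows "fact d * Determinant.det (transpose_mat A * A) =
    (\<Sum>f\<in>{..<d} \<rightarrow>\<^sub>E {..<n}. (Determinant.det (select_rows d f A))\<^sup>2)"
proof -
  let ?P = "{p. p permutes {0..<d}}" and ?F = "{..<d} \<rightarrow>\<^sub>E {..<n}"
  let ?D = "\<lambda>f. Determinant.det (select_rows d f A)"
  have perm: "Determinant.det (transpose_mat A * A) =
      (\<Sum>f\<in>?F. (\<Prod>i<d. A $$ (f (p i), i)) * (signof p * ?D f))" if p: "p \<in> ?P" for p
  proof -
    have p': "p permutes {..<d}" using p by (simp add: atLeast0LessThan)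
    have "?D (f \<circ> p) = signof p * ?D f" for f
    proof -
      have "select_rows d (f \<circ> p) A = Matrix.mat d d (\<lambda>(i, j). select_rows d f A $$ (p i, j))"
      proof (rule eq_matI)
        fix i j assume "i < dim_row (Matrix.mat d d (\<lambda>(i, j). select_rows d f A $$ (p i, j)))"
          "j < dim_col (Matrix.mat d d (\<lambda>(i, j). select_rows d f A $$ (p i, j)))"
        then show "select_rows d (f \<circ> p) A $$ (i, j) =
            Matrix.mat d d (\<lambda>(i, j). select_rows d f A $$ (p i, j)) $$ (i, j)"
          using permutes_in_image[OF p', of i] A by simp
      qed (use A in auto)
      then show ?thesis
        using det_permute_rows[of "select_rows d f A" d p] A p by simp
    qed
    moreover have "Determinant.det (transpose_mat A * A) =
        (\<Sum>f\<in>?F. (\<Prod>i<d. A $$ ((f \<circ> p) i, i)) * ?D (f \<circ> p))"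
      unfolding det_gram_expand[OF A]
      by (rule sum.reindex_bij_betw[OF bij_betw_PiE_permute[OF p'], symmetric])
    ultimately show ?thesis by simp
  qed
  have "fact d * Determinant.det (transpose_mat A * A) =
      (\<Sum>p\<in>?P. Determinant.det (transpose_mat A * A))"
    by (simp add: card_permutations)
  also have "\<dots> = (\<Sum>p\<in>?P. \<Sum>f\<in>?F. (\<Prod>i<d. A $$ (f (p i), i)) * (signof p * ?D f))"
    using perm by (intro sum.cong) auto
  also have "\<dots> = (\<Sum>f\<in>?F. \<Sum>p\<in>?P. (\<Prod>i<d. A $$ (f (p i), i)) * (signof p * ?D f))"
    by (rule sum.swap)
  also have "\<dots> = (\<Sum>f\<in>?F. ?D f * (\<Sum>p\<in>?P. signof p * (\<Prod>i<d. A $$ (f (p i), i))))"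
    by (simp add: sum_distrib_left mult_ac)
  also have "\<dots> = (\<Sum>f\<in>?F. ?D f * ?D f)"
  proof (intro sum.cong refl arg_cong2[of _ _ _ _ "(*)"])
    fix f
    \<comment> \<open>The permutation now acts on the row index, so the column form of the Leibniz
      formula is the matching one.\<close>
    have "?D f = (\<Sum>p\<in>?P. signof p * (\<Prod>i<d. select_rows d f A $$ (p i, i)))"
      using A by (intro det_col) auto
    also have "\<dots> = (\<Sum>p\<in>?P. signof p * (\<Prod>i<d. A $$ (f (p i), i)))"
    proof (intro sum.cong refl arg_cong2[of _ _ _ _ "(*)"] prod.cong)
      fix p i assume "p \<in> ?P" "i \<in> {..<d}"
      then have "p i < d" "i < d" using permutes_in_image[of p "{0..<d}" i] by auto
      then show "select_rows d f A $$ (p i, i) = A $$ (f (p i), i)" using A by simp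
    qed
    finally show "(\<Sum>p\<in>?P. signof p * (\<Prod>i<d. A $$ (f (p i), i))) = ?D f" ..
  qed
  finally show ?thesis by (simp add: power2_eq_square)
qed

section \<open>From maps back to row sets\<close>

text \<open>The Gram matrix sums over the selected rows, so it sees only the image of
  \<open>f\<close>. This is why the increasing order in \<open>row_submatrix\<close> may be replaced
  by any other enumeration.\<close>

lemma transpose_select_rows_mult:
  fixes A :: "'a :: comm_semiring_1 mat"
  assumes "inj_on f {..<k}" "f ` {..<k} \<subseteq> {..<dim_row A}"
  shows "transpose_mat (select_rows k f A) * select_rows k f A =
    Matrix.mat (dim_col A) (dim_col A) (\<lambda>(i, j). \<Sum>s\<in>f ` {..<k}. A $$ (s, i) * A $$ (s, j))"
  by (rule eq_matI)
    (use assms in \<open>auto simp: scalar_prod_def sum.reindex atLeast0LessThan intro!: sum.cong\<close>)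

lemma gram_det_select_rows:
  assumes "A \<in> carrier_mat n d"
  shows "gram_det (select_rows d f A) = (Determinant.det (select_rows d f A))\<^sup>2"
proof -
  have B: "select_rows d f A \<in> carrier_mat d d" using assms by simp
  then show ?thesis
    unfolding gram_det_def det_mult[OF transpose_carrier_mat[THEN iffD2, OF B] B] det_transpose[OF B]
    by (simp add: power2_eq_square)
qed

lemma bij_betw_pick:
  assumes "finite S"
  shows "bij_betw (pick S) {..<card S} S"
proof -
  have "inj_on (pick S) {..<card S}"
    by (intro linorder_inj_onI) (auto dest: pick_mono_le)
  moreover have "pick S ` {..<card S} \<subseteq> S"
    by (auto intro: pick_in_set_le)
  ultimately show ?thesis
    using assms by (simp add: bij_betw_def card_image card_subset_eq)
qed

lemma row_submatrix_eq_select_rows: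
  assumes "S \<subseteq> {..<dim_row A}"
  shows "row_submatrix A S = select_rows (card S) (pick S) A"
proof -
  have "{i. i < dim_row A \<and> i \<in> S} = S" using assms by auto
  \<comment> \<open>\<open>pick_card_in_set\<close> locates an element by the number of smaller
    elements of the set; in an initial segment that number is the element itself.\<close>
  moreover have "pick {..<dim_col A} j = j" if "j < dim_col A" for j
  proof -
    have "{a \<in> {..<dim_col A}. a < j} = {..<j}" using that by auto
    then show ?thesis using pick_card_in_set[of j "{..<dim_col A}"] that by simp
  qed
  ultimately show ?thesis
    by (auto simp: row_submatrix_def submatrix_def select_rows_def intro!: eq_matI)
qed

lemma gram_det_row_submatrix:
  assumes A: "A \<in> carrier_mat n d" and f: "inj_on f {..<d}" "f ` {..<d} \<subseteq> {..<n}"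
  shows "gram_det (row_submatrix A (f ` {..<d})) = (Determinant.det (select_rows d f A))\<^sup>2"
proof -
  let ?S = "f ` {..<d}"
  have c: "card ?S = d" using f by (simp add: card_image)
  have b: "bij_betw (pick ?S) {..<d} ?S" using bij_betw_pick[of ?S] c by simp
  have "gram_det (row_submatrix A ?S) = gram_det (select_rows d (pick ?S) A)"
    using row_submatrix_eq_select_rows[of ?S A] A f(2) c by simp
  also have "\<dots> = gram_det (select_rows d f A)"
    using transpose_select_rows_mult[of "pick ?S" d A] transpose_select_rows_mult[of f d A] b f A
    by (simp add: gram_det_def bij_betw_def)
  finally show ?thesis using gram_det_select_rows[OF A] by simp
qed

text \<open>Group the injections by their image. An injection into a set of the same finite size is
  onto, so every fibre consists of all \<open>fact (card I)\<close> bijections.\<close>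

lemma sum_inj_PiE_eq_sum_subsets:
  fixes h :: "'b set \<Rightarrow> 'c :: {comm_semiring_1, semiring_char_0}"
  assumes "finite I" "finite N"
  shows "(\<Sum>f | f \<in> I \<rightarrow>\<^sub>E N \<and> inj_on f I. h (f ` I)) =
    fact (card I) * (\<Sum>S | S \<subseteq> N \<and> card S = card I. h S)"
proof -
  let ?J = "{f. f \<in> I \<rightarrow>\<^sub>E N \<and> inj_on f I}" and ?T = "{S. S \<subseteq> N \<and> card S = card I}"
  have fin: "finite ?J" "finite ?T"
    using assms by (simp_all add: finite_PiE)
  have "(\<Sum>f\<in>?J. h (f ` I)) = (\<Sum>S\<in>?T. \<Sum>f | f \<in> ?J \<and> f ` I = S. h (f ` I))"
    using fin by (intro sum.group[symmetric]) (auto simp: card_image)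
  also have "\<dots> = (\<Sum>S\<in>?T. fact (card I) * h S)"
  proof (intro sum.cong refl)
    fix S assume S: "S \<in> ?T"
    then have fS: "finite S" using assms finite_subset by auto
    have "{f. f \<in> ?J \<and> f ` I = S} = {f \<in> I \<rightarrow>\<^sub>E S. inj_on f I}"
    proof safe
      fix f x assume "f \<in> I \<rightarrow>\<^sub>E S" "inj_on f I" "x \<in> S"
      then show "x \<in> f ` I"
        using S fS card_subset_eq[of S "f ` I"] by (auto simp: card_image)
    qed (use S in auto)
    moreover have "card {f \<in> I \<rightarrow>\<^sub>E S. inj_on f I} = fact (card I)"
      using card_inj_on_subset_funcset[OF assms(1) fS, of I] S
      by (simp add: fact_prod_rev)
    ultimately have "card {f. f \<in> ?J \<and> f ` I = S} = fact (card I)" by simp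
    moreover have "(\<Sum>f | f \<in> ?J \<and> f ` I = S. h (f ` I)) = (\<Sum>f | f \<in> ?J \<and> f ` I = S. h S)"
      by (rule sum.cong) auto
    ultimately show "(\<Sum>f | f \<in> ?J \<and> f ` I = S. h (f ` I)) = fact (card I) * h S"
      by simp
  qed
  finally show ?thesis by (simp add: sum_distrib_left)
qed

section \<open>Volume sampling weights and expectations\<close>

lemma gram_det_row_submatrix_nonneg:
  assumes A: "A \<in> carrier_mat n d" and S: "S \<subseteq> {..<n}" "card S = d"
  shows "gram_det (row_submatrix A S) \<ge> 0"
  using row_submatrix_eq_select_rows[of S A] S A gram_det_select_rows[OF A, of "pick S"] by simp

text \<open>Non-injective maps can be included because their determinant is 0. The constant
  \<open>h = 1\<close> gives the normalisation of the weights; a general \<open>h\<close> gives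
  expectations.\<close>

lemma sum_gram_det_row_submatrix:
  fixes h :: "nat set \<Rightarrow> real"
  assumes A: "A \<in> carrier_mat n d"
  shows "fact d * (\<Sum>S | S \<subseteq> {..<n} \<and> card S = d. gram_det (row_submatrix A S) * h S) =
    (\<Sum>f\<in>{..<d} \<rightarrow>\<^sub>E {..<n}. (Determinant.det (select_rows d f A))\<^sup>2 * h (f ` {..<d}))"
proof -
  let ?J = "{f. f \<in> {..<d} \<rightarrow>\<^sub>E {..<n} \<and> inj_on f {..<d}}"
  have "fact d * (\<Sum>S | S \<subseteq> {..<n} \<and> card S = d. gram_det (row_submatrix A S) * h S) =
    (\<Sum>f\<in>?J. gram_det (row_submatrix A (f ` {..<d})) * h (f ` {..<d}))"
    using sum_inj_PiE_eq_sum_subsets[of "{..<d}" "{..<n}" "\<lambda>S. gram_det (row_submatrix A S) * h S"]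
    by simp
  also have "\<dots> = (\<Sum>f\<in>?J. (Determinant.det (select_rows d f A))\<^sup>2 * h (f ` {..<d}))"
    using A by (intro sum.cong refl) (subst gram_det_row_submatrix, auto)
  also have "\<dots> = (\<Sum>f\<in>{..<d} \<rightarrow>\<^sub>E {..<n}. (Determinant.det (select_rows d f A))\<^sup>2 * h (f ` {..<d}))"
    by (rule sum.mono_neutral_left) (auto simp: finite_PiE det_select_rows_not_inj[OF A])
  finally show ?thesis .
qed

lemma gram_det_eq_sum_row_submatrix:
  assumes A: "A \<in> carrier_mat n d"
  shows "gram_det A = (\<Sum>S | S \<subseteq> {..<n} \<and> card S = d. gram_det (row_submatrix A S))"
proof -
  have "fact d * gram_det A = fact d * (\<Sum>S | S \<subseteq> {..<n} \<and> card S = d. gram_det (row_submatrix A S))"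
    using sum_gram_det_row_submatrix[OF A, of "\<lambda>_. 1"] cauchy_binet_gram[OF A]
    by (simp add: gram_det_def)
  then show ?thesis by simp
qed

lemma gram_det_nonneg:
  assumes A: "A \<in> carrier_mat n d"
  shows "gram_det A \<ge> 0"
  unfolding gram_det_eq_sum_row_submatrix[OF A]
  by (rule sum_nonneg) (auto intro: gram_det_row_submatrix_nonneg[OF A])

text \<open>The weights are nonnegative and sum to 1, so \<open>embed_pmf\<close> has them as its
  probabilities. The factors \<open>fact d\<close> and \<open>gram_det A\<close> stay on the left so
  that later comparisons are between sums over maps, without division.\<close>

lemma expectation_volume_sampling:
  fixes h :: "nat set \<Rightarrow> real"
  assumes A: "A \<in> carrier_mat n d" and nz: "gram_det A \<noteq> 0"
  shows "fact d * gram_det A * measure_pmf.expectation (volume_sampling A) h =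
    (\<Sum>f\<in>{..<d} \<rightarrow>\<^sub>E {..<n}. (Determinant.det (select_rows d f A))\<^sup>2 * h (f ` {..<d}))"
proof -
  let ?T = "{S. S \<subseteq> {..<n} \<and> card S = d}"
  define P where "P = (\<lambda>S. if S \<subseteq> {..<n} \<and> card S = d
    then gram_det (row_submatrix A S) / gram_det A else 0)"
  have fin: "finite ?T" by (rule finite_subset[of _ "Pow {..<n}"]) auto
  have pos: "gram_det A > 0" using nz gram_det_nonneg[OF A] by simp
  have P_nonneg: "P S \<ge> 0" for S
    using pos gram_det_row_submatrix_nonneg[OF A] by (simp add: P_def)
  have "(\<Sum>S\<in>?T. P S) = (\<Sum>S\<in>?T. gram_det (row_submatrix A S) / gram_det A)"
    by (rule sum.cong) (auto simp: P_def)
  then have "(\<Sum>S\<in>?T. P S) = 1"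
    using gram_det_eq_sum_row_submatrix[OF A] nz by (simp flip: sum_divide_distrib)
  moreover have "(\<integral>\<^sup>+S. ennreal (P S) \<partial>count_space UNIV) = (\<Sum>S\<in>?T. ennreal (P S))"
    by (rule nn_integral_count_space'[OF fin]) (auto simp: P_def)
  ultimately have "(\<integral>\<^sup>+S. ennreal (P S) \<partial>count_space UNIV) = 1"
    using P_nonneg by (simp add: sum_ennreal)
  then have pmf: "pmf (volume_sampling A) S = P S" for S
    using pmf_embed_pmf[of P] P_nonneg A by (simp add: volume_sampling_def P_def)
  have "measure_pmf.expectation (volume_sampling A) h = (\<Sum>S\<in>?T. h S * pmf (volume_sampling A) S)"
    by (rule integral_measure_pmf_real[OF fin]) (auto simp: set_pmf_iff pmf P_def split: if_splits)
  also have "\<dots> = (\<Sum>S\<in>?T. gram_det (row_submatrix A S) * h S) / gram_det A"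
    unfolding pmf sum_divide_distrib by (rule sum.cong) (auto simp: P_def)
  finally show ?thesis
    using sum_gram_det_row_submatrix[OF A, of h] nz by simp
qed

section \<open>The pseudoinverse and the normal equation\<close>

text \<open>Both inverses induce the same projections: by symmetry,
  \<open>A * G = (A * H) * (A * G)\<close> is the transpose of
  \<open>(A * G) * (A * H) = A * H\<close>, and likewise on the other side. Then
  \<open>G = G * A * G = H * A * H = H\<close>.\<close>

lemma moore_penrose_unique:
  assumes G: "is_moore_penrose A G" and H: "is_moore_penrose A H"
  shows "G = H"
proof -
  define n d where "n = dim_row A" and "d = dim_col A"
  have A: "A \<in> carrier_mat n d" by (simp add: n_def d_def)
  have Gc: "G \<in> carrier_mat d n" and Hc: "H \<in> carrier_mat d n"
    using G H by (auto simp: is_moore_penrose_def n_def d_def)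
  have g: "A * G * A = A" "G * A * G = G" "transpose_mat (A * G) = A * G" "transpose_mat (G * A) = G * A"
    using G by (auto simp: is_moore_penrose_def)
  have h: "A * H * A = A" "H * A * H = H" "transpose_mat (A * H) = A * H" "transpose_mat (H * A) = H * A"
    using H by (auto simp: is_moore_penrose_def)
  have AG: "A * G \<in> carrier_mat n n" and AH: "A * H \<in> carrier_mat n n"
    and GA: "G * A \<in> carrier_mat d d" and HA: "H * A \<in> carrier_mat d d"
    using A Gc Hc by auto
  have "A * G = A * H * A * G" by (simp only: h)
  also have "\<dots> = (A * H) * (A * G)" by (rule assoc_mult_mat[OF AH A Gc])
  also have "\<dots> = transpose_mat ((A * G) * (A * H))"
    by (simp only: transpose_mult[OF AG AH] g h)
  also have "(A * G) * (A * H) = A * G * A * H" by (rule assoc_mult_mat[OF AG A Hc, symmetric])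
  finally have eq1: "A * G = A * H" by (simp only: g h)
  have "G * A = G * (A * H * A)" by (simp only: h)
  also have "\<dots> = (G * A) * (H * A)"
    by (simp only: assoc_mult_mat[OF A Hc A] assoc_mult_mat[OF Gc A HA])
  also have "\<dots> = transpose_mat ((H * A) * (G * A))"
    by (simp only: transpose_mult[OF HA GA] g h)
  also have "(H * A) * (G * A) = H * (A * G * A)"
    by (simp only: assoc_mult_mat[OF A Gc A] assoc_mult_mat[OF Hc A GA])
  finally have eq2: "G * A = H * A" by (simp only: g h)
  have "G = H * A * G" using g(2) by (simp only: eq2)
  also have "\<dots> = H * (A * H)" by (simp only: assoc_mult_mat[OF Hc A Gc] eq1)
  also have "\<dots> = H * A * H" by (rule assoc_mult_mat[OF Hc A Hc, symmetric])
  finally show ?thesis by (simp only: h)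
qed

text \<open>For invertible \<open>K = transpose_mat A * A\<close> the pseudoinverse is the inverse
  of \<open>K\<close> times the transpose of \<open>A\<close>. The inverse \<open>M\<close> is built
  from the adjugate, and is exposed because \<open>normal_equation\<close> needs it.\<close>

lemma moore_penrose_full_column_rank:
  assumes A: "A \<in> carrier_mat n d" and nz: "gram_det A \<noteq> 0"
  obtains M where "M \<in> carrier_mat d d" "transpose_mat A * A * M = 1\<^sub>m d"
    "is_moore_penrose A (M * transpose_mat A)"
proof -
  define K where "K = transpose_mat A * A"
  define M where "M = (1 / gram_det A) \<cdot>\<^sub>m adj_mat K"
  have At: "transpose_mat A \<in> carrier_mat d n" using A by simp
  have K: "K \<in> carrier_mat d d" using A by (simp add: K_def)
  have Kt: "transpose_mat K = K" by (simp add: K_def transpose_mult[OF At A])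
  have dK: "Determinant.det K = gram_det A" by (simp add: K_def gram_det_def)
  have M: "M \<in> carrier_mat d d" using adj_mat(1)[OF K] by (simp add: M_def)
  have KM: "K * M = 1\<^sub>m d" and MK: "M * K = 1\<^sub>m d"
    using K adj_mat[OF K] nz
    by (auto simp: M_def dK mult_smult_distrib[OF K] mult_smult_assoc_mat[OF _ K])
  \<comment> \<open>The inverse of a symmetric matrix is symmetric; this yields the symmetry of
    \<open>A * M * transpose_mat A\<close> below.\<close>
  have "M = M * transpose_mat (M * K)" unfolding MK using M by simp
  also have "\<dots> = M * K * transpose_mat M"
    using M K by (simp add: transpose_mult[OF M K] Kt)
  finally have Mt: "transpose_mat M = M" using M MK by simp
  have GA: "M * transpose_mat A * A = 1\<^sub>m d"
    using MK M At A by (simp add: K_def)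
  have G: "M * transpose_mat A \<in> carrier_mat d n" using M At by simp
  have "is_moore_penrose A (M * transpose_mat A)"
    unfolding is_moore_penrose_def
  proof (intro conjI)
    show "A * (M * transpose_mat A) * A = A"
      using GA assoc_mult_mat[OF A G A] A by simp
    show "M * transpose_mat A * A * (M * transpose_mat A) = M * transpose_mat A"
      unfolding GA by (rule left_mult_one_mat[OF G])
    show "transpose_mat (A * (M * transpose_mat A)) = A * (M * transpose_mat A)"
      unfolding transpose_mult[OF A G] transpose_mult[OF M At] Mt transpose_transpose
      using assoc_mult_mat[OF A M At] .
    show "transpose_mat (M * transpose_mat A * A) = M * transpose_mat A * A"
      unfolding GA by simp
  qed (use A M in auto)
  then show ?thesis using that[of M] M KM unfolding K_def by blast
qed

lemma pseudoinverse_eqI: "is_moore_penrose A G \<Longrightarrow> pseudoinverse A = G"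
  unfolding pseudoinverse_def by (blast intro: moore_penrose_unique)

lemma lsq_solution_carrier:
  assumes A: "A \<in> carrier_mat n d" and nz: "gram_det A \<noteq> 0"
  shows "lsq_solution A b \<in> carrier_vec d"
proof -
  obtain M where "M \<in> carrier_mat d d" "is_moore_penrose A (M * transpose_mat A)"
    using moore_penrose_full_column_rank[OF A nz] by metis
  then show ?thesis
    using A by (auto simp: lsq_solution_def pseudoinverse_eqI intro!: carrier_vecI)
qed

text \<open>The residual is orthogonal to all columns. This serves the full problem, where it splits
  a Gram matrix, and the square subproblems, where it forces the residual to vanish.\<close>

lemma normal_equation:
  assumes A: "A \<in> carrier_mat n d" and nz: "gram_det A \<noteq> 0" and b: "b \<in> carrier_vec n"
  shows "transpose_mat A *\<^sub>v (b - A *\<^sub>v lsq_solution A b) = 0\<^sub>v d"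
proof -
  obtain M where M: "M \<in> carrier_mat d d" "transpose_mat A * A * M = 1\<^sub>m d"
    "is_moore_penrose A (M * transpose_mat A)"
    using moore_penrose_full_column_rank[OF A nz] by metis
  have At: "transpose_mat A \<in> carrier_mat d n" using A by simp
  have w: "lsq_solution A b = M *\<^sub>v (transpose_mat A *\<^sub>v b)"
    using pseudoinverse_eqI[OF M(3)] M(1) At b by (simp add: lsq_solution_def)
  have Ab: "transpose_mat A *\<^sub>v b \<in> carrier_vec d" using At b by simp
  have "transpose_mat A *\<^sub>v (A *\<^sub>v lsq_solution A b) = (transpose_mat A * A * M) *\<^sub>v (transpose_mat A *\<^sub>v b)"
    using assoc_mult_mat_vec[OF mult_carrier_mat[OF At A] M(1) Ab]
      assoc_mult_mat_vec[OF At A mult_mat_vec_carrier[OF M(1) Ab]] by (simp only: w)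
  also have "\<dots> = transpose_mat A *\<^sub>v b" using Ab by (simp add: M(2))
  finally have eq: "transpose_mat A *\<^sub>v (A *\<^sub>v lsq_solution A b) = transpose_mat A *\<^sub>v b" .
  have "A *\<^sub>v lsq_solution A b \<in> carrier_vec n"
    using A lsq_solution_carrier[OF A nz] by simp
  from mult_minus_distrib_mat_vec[OF At b this] show ?thesis
    unfolding eq using Ab by simp
qed

section \<open>Subproblems with an invertible row selection\<close>

lemma lsq_solution_subproblem_carrier:
  assumes A: "A \<in> carrier_mat n d"
    and f: "inj_on f {..<d}" "f ` {..<d} \<subseteq> {..<n}"
    and nz: "Determinant.det (select_rows d f A) \<noteq> 0"
  shows "lsq_solution (row_submatrix A (f ` {..<d})) b \<in> carrier_vec d"
proof -
  have "row_submatrix A (f ` {..<d}) \<in> carrier_mat d d"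
    using row_submatrix_eq_select_rows[of "f ` {..<d}" A] A f(2) card_image[OF f(1)] by auto
  moreover have "gram_det (row_submatrix A (f ` {..<d})) \<noteq> 0"
    using nz unfolding gram_det_row_submatrix[OF A f] by simp
  ultimately show ?thesis by (rule lsq_solution_carrier)
qed

lemma lsq_solution_subproblem_interpolates:
  assumes A: "A \<in> carrier_mat n d" and y: "y \<in> carrier_vec n"
    and f: "inj_on f {..<d}" "f ` {..<d} \<subseteq> {..<n}"
    and nz: "Determinant.det (select_rows d f A) \<noteq> 0" and s: "s \<in> f ` {..<d}"
  defines "w \<equiv> lsq_solution (row_submatrix A (f ` {..<d})) (subvector y (f ` {..<d}))"
  shows "vec_index (A *\<^sub>v w) s = vec_index y s"
proof -
  define S where "S = f ` {..<d}"
  have S: "S \<subseteq> {..<n}" "card S = d" "finite S"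
    using f by (auto simp: S_def card_image)
  have B_eq: "row_submatrix A S = select_rows d (pick S) A"
    using row_submatrix_eq_select_rows[of S A] S A by auto
  define B where "B = select_rows d (pick S) A"
  have B: "B \<in> carrier_mat d d" using A by (simp add: B_def)
  have gB: "gram_det B \<noteq> 0"
    using gram_det_row_submatrix[OF A f] nz by (simp add: B_def S_def[symmetric] B_eq)
  have "{i. i < dim_vec y \<and> i \<in> S} = S" using S y by auto
  then have b: "subvector y S = Matrix.vec d (\<lambda>i. vec_index y (pick S i))"
    using S by (simp add: subvector_def)
  have wB: "w = lsq_solution B (subvector y S)"
    by (simp add: w_def S_def[symmetric] B_eq B_def)
  have w: "w \<in> carrier_vec d" unfolding wB by (rule lsq_solution_carrier[OF B gB])
  have bc: "subvector y S \<in> carrier_vec d" by (simp add: b)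
  have Bw: "B *\<^sub>v w \<in> carrier_vec d" using B w by simp
  have "Determinant.det B \<noteq> 0"
    using gram_det_select_rows[OF A, of "pick S"] gB by (simp add: B_def)
  then have "Determinant.det (transpose_mat B) \<noteq> 0" by (simp add: det_transpose[OF B])
  moreover have "transpose_mat B *\<^sub>v (subvector y S - B *\<^sub>v w) = 0\<^sub>v d"
    unfolding wB by (rule normal_equation[OF B gB bc])
  moreover have Bt: "transpose_mat B \<in> carrier_mat d d" using B by simp
  \<comment> \<open>The transpose of \<open>B\<close> annihilates the residual and is invertible, so
    the residual is zero.\<close>
  ultimately have zero: "subvector y S - B *\<^sub>v w = 0\<^sub>v d"
    using det_0_iff_vec_prod_zero[OF Bt] minus_carrier_vec[OF bc Bw] by metis
  then have eq: "vec_index (B *\<^sub>v w) i = vec_index y (pick S i)" if "i < d" for i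
  proof -
    have "vec_index (subvector y S) i - vec_index (B *\<^sub>v w) i = vec_index (subvector y S - B *\<^sub>v w) i"
      using that B by (intro index_minus_vec(1)[symmetric]) auto
    also have "\<dots> = 0" unfolding zero using that by simp
    finally show ?thesis using that by (simp add: b del: index_mult_mat_vec)
  qed
  have sS: "s \<in> S" using s unfolding S_def .
  have "pick S ` {..<d} = S" using bij_betw_imp_surj_on[OF bij_betw_pick[OF S(3)]] S(2) by simp
  then have "s \<in> pick S ` {..<d}" using sS by simp
  then obtain i where i: "i < d" "s = pick S i" by auto
  have "pick S i < n" using sS S(1) i(2) by auto
  then show ?thesis
    using eq[OF i(1)] select_rows_mult_vec[OF A i(1), of "pick S" w]
    unfolding B_def i(2) by (simp only:)
qed

section \<open>Full rank and the Gram determinant\<close>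

text \<open>A kernel vector \<open>v\<close> of the Gram matrix satisfies
  \<open>A *\<^sub>v v = 0\<close>, since the squared length of \<open>A *\<^sub>v v\<close> is the
  scalar product of the Gram matrix applied to \<open>v\<close> with \<open>v\<close>. That is a
  linear dependence among the columns.\<close>

lemma gram_det_full_rank:
  assumes A: "A \<in> carrier_mat n d" and rank: "vec_space.rank n A = d"
  shows "gram_det A \<noteq> 0"
proof
  interpret vec_space "TYPE(real)" n .
  have At: "transpose_mat A \<in> carrier_mat d n" using A by simp
  \<comment> \<open>Linear dependence is stated for the set of columns, where repetitions disappear.
    A repeated column would leave fewer than \<open>d\<close> vectors, too few for a maximal
    independent subset of size \<open>d\<close>.\<close>
  have dist: "distinct (cols A)"
  proof (rule ccontr)
    assume nd: "\<not> distinct (cols A)"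
    obtain S where S: "maximal S (\<lambda>T. T \<subseteq> set (cols A) \<and> lin_indpt T)"
      using maximal_exists[of "(\<lambda>T. T \<subseteq> set (cols A) \<and> lin_indpt T)" "card (set (cols A))" "{}"]
      by (meson List.finite_set card_mono empty_iff empty_subsetI finite_lin_indpt2 rev_finite_subset)
    have "card S \<le> card (set (cols A))" using S by (simp add: card_mono maximal_def)
    moreover have "card (set (cols A)) \<noteq> length (cols A)" using nd card_distinct by blast
    ultimately have "card S < length (cols A)" using card_length[of "cols A"] by linarith
    moreover have "card S = d" using rank_card_indpt[OF A S] unfolding rank by (rule sym)
    ultimately show False using carrier_matD(2)[OF A] unfolding cols_length by linarith
  qed
  assume "gram_det A = 0"
  then obtain v where v: "v \<in> carrier_vec d" "v \<noteq> 0\<^sub>v d" "(transpose_mat A * A) *\<^sub>v v = 0\<^sub>v d"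
    using det_0_iff_vec_prod_zero[OF mult_carrier_mat[OF At A]] by (auto simp: gram_det_def)
  have Av: "A *\<^sub>v v \<in> carrier_vec n" using A v by simp
  have dim: "dim_vec (A *\<^sub>v v) = n" using carrier_vecD[OF Av] .
  have "scalar_prod (A *\<^sub>v v) (A *\<^sub>v v) = scalar_prod (transpose_mat A *\<^sub>v (A *\<^sub>v v)) v"
    by (rule transpose_vec_mult_scalar[OF A v(1) Av, symmetric])
  also have "\<dots> = 0"
    unfolding assoc_mult_mat_vec[OF At A v(1), symmetric] v(3) using v(1) by simp
  finally have "(\<Sum>i<n. (vec_index (A *\<^sub>v v) i)\<^sup>2) = 0"
    unfolding scalar_prod_def dim atLeast0LessThan power2_eq_square .
  then have "\<forall>i<n. vec_index (A *\<^sub>v v) i = 0"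
    by (subst (asm) sum_nonneg_eq_0_iff) auto
  then have "A *\<^sub>v v = 0\<^sub>v n"
    using dim by (intro eq_vecI) (simp_all del: index_mult_mat_vec)
  then have "lin_dep (set (cols A))" by (rule lin_depI[OF A v(1,2) _ dist])
  then show False using full_rank_lin_indpt[OF A rank dist] by simp
qed

section \<open>The matrix augmented by the response column\<close>

definition augment_col :: "'a mat \<Rightarrow> 'a Matrix.vec \<Rightarrow> 'a mat" where
  "augment_col A b = Matrix.mat (dim_row A) (Suc (dim_col A))
     (\<lambda>(i, j). if j < dim_col A then A $$ (i, j) else vec_index b i)"

lemma augment_col_carrier:
  "A \<in> carrier_mat n d \<Longrightarrow> augment_col A b \<in> carrier_mat n (Suc d)"
  by (simp add: augment_col_def)

text \<open>\<open>U\<close> is a column operation: the identity matrix with \<open>- w\<close>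
  placed above its last corner, so that multiplication by it subtracts \<open>A *\<^sub>v w\<close>
  from the last column.\<close>

lemma augment_col_residual:
  fixes A :: "'a :: comm_ring_1 mat"
  assumes A: "A \<in> carrier_mat n d" and w: "w \<in> carrier_vec d" and b: "b \<in> carrier_vec n"
  defines "U \<equiv> Matrix.mat (Suc d) (Suc d)
    (\<lambda>(i, j). if i = j then 1 else if j = d then - vec_index w i else 0)"
  shows "augment_col A (b - A *\<^sub>v w) = augment_col A b * U"
proof (rule eq_matI)
  fix i j assume "i < dim_row (augment_col A b * U)" "j < dim_col (augment_col A b * U)"
  then have i: "i < n" and j: "j < Suc d" using A by (auto simp: augment_col_def U_def)
  have "(augment_col A b * U) $$ (i, j) = (\<Sum>k<Suc d. augment_col A b $$ (i, k) * U $$ (k, j))"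
    using i j A by (simp add: augment_col_def U_def scalar_prod_def atLeast0LessThan)
  also have "\<dots> = (\<Sum>k<d. A $$ (i, k) * U $$ (k, j)) + vec_index b i * U $$ (d, j)"
    using i A by (simp add: augment_col_def)
  also have "\<dots> = augment_col A (b - A *\<^sub>v w) $$ (i, j)"
  proof (cases "j = d")
    case True
    have "(\<Sum>k<d. A $$ (i, k) * U $$ (k, j)) = - (\<Sum>k<d. A $$ (i, k) * vec_index w k)"
      unfolding sum_negf[symmetric] by (rule sum.cong) (auto simp: U_def True)
    then show ?thesis
      using i A w b by (simp add: True augment_col_def U_def scalar_prod_def atLeast0LessThan)
  next
    case False
    then have "j < d" using j by simp
    have "(\<Sum>k<d. A $$ (i, k) * U $$ (k, j)) = (\<Sum>k<d. if k = j then A $$ (i, k) else 0)"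
      by (rule sum.cong) (use False j in \<open>auto simp: U_def\<close>)
    then show ?thesis
      using i A \<open>j < d\<close> by (simp add: augment_col_def U_def)
  qed
  finally show "augment_col A (b - A *\<^sub>v w) $$ (i, j) = (augment_col A b * U) $$ (i, j)" ..
qed (use A in \<open>auto simp: augment_col_def U_def\<close>)

text \<open>The column operation has determinant 1 and commutes with selecting rows. Since
  \<open>w\<close> is arbitrary, this applies both to the full solution and to that of a
  subproblem.\<close>

lemma det_select_augment_residual:
  fixes A :: "'a :: comm_ring_1 mat"
  assumes A: "A \<in> carrier_mat n d" and w: "w \<in> carrier_vec d" and b: "b \<in> carrier_vec n"
    and g: "\<And>i. i < Suc d \<Longrightarrow> g i < n"
  shows "Determinant.det (select_rows (Suc d) g (augment_col A (b - A *\<^sub>v w))) =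
    Determinant.det (select_rows (Suc d) g (augment_col A b))"
proof -
  let ?U = "Matrix.mat (Suc d) (Suc d)
    (\<lambda>(i, j). if i = j then 1 else if j = d then - vec_index w i else 0)"
  have U: "?U \<in> carrier_mat (Suc d) (Suc d)" by simp
  have "Determinant.det ?U = 1"
    by (subst det_upper_triangular[OF _ U]) (auto simp: upper_triangular_def prod_list_diag_prod)
  moreover have "select_rows (Suc d) g (augment_col A (b - A *\<^sub>v w)) =
      select_rows (Suc d) g (augment_col A b) * ?U"
    unfolding augment_col_residual[OF A w b]
    by (rule select_rows_mult[OF augment_col_carrier[OF A] U g])
  ultimately show ?thesis
    by (simp add: det_mult[OF select_rows_carrier[OF augment_col_carrier[OF A]] U])
qed

lemma det_last_col:
  fixes B :: "'a :: comm_ring_1 mat"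
  assumes B: "B \<in> carrier_mat (Suc d) (Suc d)" and z: "\<And>i. i < d \<Longrightarrow> B $$ (i, d) = 0"
  shows "Determinant.det B =
    B $$ (d, d) * Determinant.det (Matrix.mat d d (\<lambda>(i, j). B $$ (i, j)))"
proof -
  have "mat_delete B d d = Matrix.mat d d (\<lambda>(i, j). B $$ (i, j))"
    using B by (auto simp: mat_delete_def intro!: eq_matI)
  then show ?thesis
    using laplace_expansion_column[OF B, of d] z by (simp add: cofactor_def)
qed

text \<open>Residuals are taken as \<open>b - A *\<^sub>v w\<close>, opposite in sign to
  \<open>square_loss\<close>; squaring removes the difference.\<close>

lemma square_loss_eq_sum:
  assumes "A \<in> carrier_mat n d" "w \<in> carrier_vec d" "b \<in> carrier_vec n"
  shows "square_loss A b w = (\<Sum>i<n. (vec_index (b - A *\<^sub>v w) i)\<^sup>2)"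
  unfolding square_loss_def scalar_prod_def using assms
  by (auto intro!: sum.cong simp: atLeast0LessThan power2_eq_square algebra_simps)

text \<open>Geometrically, a further column multiplies the squared volume by its squared distance
  from the column space. Once \<open>b\<close> is replaced by the residual, orthogonality makes the
  Gram matrix block diagonal, with the loss in the corner.\<close>

lemma gram_det_augment_col:
  assumes A: "A \<in> carrier_mat n d" and nz: "gram_det A \<noteq> 0" and b: "b \<in> carrier_vec n"
  shows "gram_det (augment_col A b) = gram_det A * square_loss A b (lsq_solution A b)"
proof -
  define w where "w = lsq_solution A b"
  have w: "w \<in> carrier_vec d" unfolding w_def by (rule lsq_solution_carrier[OF A nz])
  define r where "r = b - A *\<^sub>v w"
  have r: "r \<in> carrier_vec n"
    unfolding r_def using b A w by (intro minus_carrier_vec mult_mat_vec_carrier)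
  have orth: "transpose_mat A *\<^sub>v r = 0\<^sub>v d"
    unfolding r_def w_def by (rule normal_equation[OF A nz b])
  define Z where "Z = augment_col A r"
  define K where "K = transpose_mat Z * Z"
  have Z: "Z \<in> carrier_mat n (Suc d)" unfolding Z_def by (rule augment_col_carrier[OF A])
  have Z_left: "Z $$ (s, i) = A $$ (s, i)" if "s < n" "i < d" for s i
    using that A by (simp add: Z_def augment_col_def)
  have Z_right: "Z $$ (s, d) = vec_index r s" if "s < n" for s
    using that A by (simp add: Z_def augment_col_def)
  have K: "K \<in> carrier_mat (Suc d) (Suc d)" using Z by (simp add: K_def)
  have K_index: "K $$ (i, j) = (\<Sum>s<n. Z $$ (s, i) * Z $$ (s, j))" if "i \<le> d" "j \<le> d" for i j
    using that Z by (simp add: K_def scalar_prod_def atLeast0LessThan)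
  \<comment> \<open>Replacing \<open>b\<close> by the residual changes no maximal minor, so by
    Cauchy-Binet it does not change the Gram determinant.\<close>
  have "fact (Suc d) * gram_det (augment_col A b) = (fact (Suc d) * gram_det Z :: real)"
    unfolding gram_det_def cauchy_binet_gram[OF Z] cauchy_binet_gram[OF augment_col_carrier[OF A]]
  proof (intro sum.cong refl arg_cong[where f = "\<lambda>x. x\<^sup>2"])
    fix g assume "g \<in> {..<Suc d} \<rightarrow>\<^sub>E {..<n}"
    then have g: "g i < n" if "i < Suc d" for i
      using PiE_mem[of g "{..<Suc d}" "\<lambda>_. {..<n}" i] that by simp
    show "Determinant.det (select_rows (Suc d) g (augment_col A b)) =
        Determinant.det (select_rows (Suc d) g Z)"
      unfolding Z_def r_def by (rule det_select_augment_residual[OF A w b g, symmetric])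
  qed
  then have "gram_det (augment_col A b) = gram_det Z" by simp
  also have "gram_det Z = K $$ (d, d) * Determinant.det (Matrix.mat d d (\<lambda>(i, j). K $$ (i, j)))"
    unfolding gram_det_def K_def[symmetric]
  proof (rule det_last_col[OF K])
    fix i assume i: "i < d"
    have "K $$ (i, d) = (\<Sum>s<n. A $$ (s, i) * vec_index r s)"
      using i by (simp add: K_index Z_left Z_right)
    also have "\<dots> = vec_index (transpose_mat A *\<^sub>v r) i"
      using i A r by (simp add: scalar_prod_def atLeast0LessThan)
    finally show "K $$ (i, d) = 0" using i unfolding orth by simp
  qed
  also have "Matrix.mat d d (\<lambda>(i, j). K $$ (i, j)) = transpose_mat A * A"
    using A by (intro eq_matI) (simp_all add: K_index Z_left scalar_prod_def atLeast0LessThan)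
  also have "K $$ (d, d) = square_loss A b w"
    unfolding square_loss_eq_sum[OF A w b] r_def[symmetric]
    by (simp add: K_index Z_right power2_eq_square)
  finally show ?thesis by (simp add: gram_det_def w_def)
qed

text \<open>After \<open>b\<close> is replaced by the residual, the last column vanishes in the
  interpolated rows and only its corner survives. Row \<open>s\<close> is appended in the last
  position, so no sign appears; if \<open>s\<close> is already among the rows \<open>f i\<close>,
  both sides are 0.\<close>

lemma det_select_augment_interpolating:
  fixes A :: "'a :: comm_ring_1 mat"
  assumes A: "A \<in> carrier_mat n d" and w: "w \<in> carrier_vec d" and b: "b \<in> carrier_vec n"
    and f: "\<And>i. i < d \<Longrightarrow> f i < n" and s: "s < n"
    and int: "\<And>i. i < d \<Longrightarrow> vec_index (A *\<^sub>v w) (f i) = vec_index b (f i)"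
  shows "Determinant.det (select_rows (Suc d) (f(d := s)) (augment_col A b)) =
    vec_index (b - A *\<^sub>v w) s * Determinant.det (select_rows d f A)"
proof -
  let ?Z = "augment_col A (b - A *\<^sub>v w)"
  let ?B = "select_rows (Suc d) (f(d := s)) ?Z"
  have "Determinant.det (select_rows (Suc d) (f(d := s)) (augment_col A b)) = Determinant.det ?B"
    using f s by (intro det_select_augment_residual[OF A w b, symmetric]) auto
  also have "\<dots> = ?B $$ (d, d) * Determinant.det (Matrix.mat d d (\<lambda>(i, j). ?B $$ (i, j)))"
  proof (rule det_last_col)
    show "?B \<in> carrier_mat (Suc d) (Suc d)"
      by (rule select_rows_carrier[OF augment_col_carrier[OF A]])
    show "?B $$ (i, d) = 0" if "i < d" for i
      using that f[OF that] int[OF that] A b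
      by (simp add: select_rows_def augment_col_def del: index_mult_mat_vec)
  qed
  also have "Matrix.mat d d (\<lambda>(i, j). ?B $$ (i, j)) = select_rows d f A"
    using f A by (intro eq_matI) (auto simp: select_rows_def augment_col_def)
  also have "?B $$ (d, d) = vec_index (b - A *\<^sub>v w) s"
    using s A by (simp add: select_rows_def augment_col_def)
  finally show ?thesis .
qed

section \<open>Double counting and the final comparison\<close>

text \<open>Choosing \<open>d\<close> rows and then one more row \<open>s\<close> is the same as
  choosing \<open>d + 1\<close> rows. This is the double counting of pairs of a \<open>d\<close>-set
  and an extra row, in the language of maps.\<close>

lemma sum_PiE_lessThan_Suc:
  fixes h :: "(nat \<Rightarrow> 'b) \<Rightarrow> 'c :: comm_monoid_add"
  shows "(\<Sum>g\<in>{..<Suc d} \<rightarrow>\<^sub>E N. h g) = (\<Sum>f\<in>{..<d} \<rightarrow>\<^sub>E N. \<Sum>s\<in>N. h (f(d := s)))"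
proof -
  have "(\<Sum>g\<in>{..<Suc d} \<rightarrow>\<^sub>E N. h g) = (\<Sum>(s, f)\<in>N \<times> ({..<d} \<rightarrow>\<^sub>E N). h (f(d := s)))"
    unfolding lessThan_Suc PiE_insert_eq
    by (subst sum.reindex[OF inj_combinator]) (simp_all add: split_def)
  also have "\<dots> = (\<Sum>s\<in>N. \<Sum>f\<in>{..<d} \<rightarrow>\<^sub>E N. h (f(d := s)))"
    by (rule sum.cartesian_product[symmetric])
  finally show ?thesis by (simp add: sum.swap[of _ N])
qed

lemma det_sq_mult_loss_subproblem:
  assumes A: "A \<in> carrier_mat n d" and y: "y \<in> carrier_vec n"
    and f: "f \<in> {..<d} \<rightarrow>\<^sub>E {..<n}" and nz: "Determinant.det (select_rows d f A) \<noteq> 0"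
  shows "(Determinant.det (select_rows d f A))\<^sup>2 *
      square_loss A y (lsq_solution (row_submatrix A (f ` {..<d})) (subvector y (f ` {..<d}))) =
    (\<Sum>s<n. (Determinant.det (select_rows (Suc d) (f(d := s)) (augment_col A y)))\<^sup>2)"
proof -
  \<comment> \<open>A nonzero determinant excludes repeated rows, so the image of \<open>f\<close>
    is a genuine \<open>d\<close>-set with an invertible subproblem.\<close>
  have inj: "inj_on f {..<d}" using det_select_rows_not_inj[OF A] nz by blast
  have im: "f ` {..<d} \<subseteq> {..<n}" using f by auto
  let ?w = "lsq_solution (row_submatrix A (f ` {..<d})) (subvector y (f ` {..<d}))"
  have w: "?w \<in> carrier_vec d" by (rule lsq_solution_subproblem_carrier[OF A inj im nz])
  have "Determinant.det (select_rows (Suc d) (f(d := s)) (augment_col A y)) =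
      vec_index (y - A *\<^sub>v ?w) s * Determinant.det (select_rows d f A)" if "s < n" for s
    using f that lsq_solution_subproblem_interpolates[OF A y inj im nz]
    by (intro det_select_augment_interpolating[OF A w y]) auto
  then show ?thesis
    unfolding square_loss_eq_sum[OF A w y] sum_distrib_left
    by (intro sum.cong) (auto simp: power_mult_distrib)
qed

theorem theorem3p1:
  fixes n d :: nat and X :: "real mat" and y :: "real Matrix.vec"
  assumes "X \<in> carrier_mat n d" and "y \<in> carrier_vec n"
    and "d \<le> n" and "vec_space.rank n X = d"
  shows "(general_position X \<longrightarrow>
           measure_pmf.expectation (volume_sampling X)
             (\<lambda>S. square_loss X y (lsq_solution (row_submatrix X S) (subvector y S)))
           = (real d + 1) * square_loss X y (lsq_solution X y))
       \<and> (\<not> general_position X \<longrightarrow>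
           measure_pmf.expectation (volume_sampling X)
             (\<lambda>S. square_loss X y (lsq_solution (row_submatrix X S) (subvector y S)))
           \<le> (real d + 1) * square_loss X y (lsq_solution X y))"
proof -
  note X = assms(1) and y = assms(2)
  have nz: "gram_det X \<noteq> 0" by (rule gram_det_full_rank[OF X assms(4)])
  have pos: "gram_det X > 0"
    using nz gram_det_nonneg[OF X] by simp
  define L where "L = (\<lambda>S. square_loss X y (lsq_solution (row_submatrix X S) (subvector y S)))"
  define E where "E = measure_pmf.expectation (volume_sampling X) L"
  let ?F = "{..<d} \<rightarrow>\<^sub>E {..<n}"
  let ?D = "\<lambda>f. Determinant.det (select_rows d f X)"
  let ?R = "\<lambda>f. \<Sum>s<n. (Determinant.det (select_rows (Suc d) (f(d := s)) (augment_col X y)))\<^sup>2"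
  have lhs: "fact d * gram_det X * E = (\<Sum>f\<in>?F. (?D f)\<^sup>2 * L (f ` {..<d}))"
    unfolding E_def by (rule expectation_volume_sampling[OF X nz])
  have "(\<Sum>f\<in>?F. ?R f) = fact (Suc d) * gram_det (augment_col X y)"
    unfolding gram_det_def cauchy_binet_gram[OF augment_col_carrier[OF X]]
    by (rule sum_PiE_lessThan_Suc[symmetric])
  \<comment> \<open>The factor \<open>d + 1\<close> of the theorem arises here, as the quotient of
    \<open>fact (Suc d)\<close> and \<open>fact d\<close>.\<close>
  then have rhs: "(\<Sum>f\<in>?F. ?R f) =
      fact d * gram_det X * ((real d + 1) * square_loss X y (lsq_solution X y))"
    unfolding gram_det_augment_col[OF X nz y] fact_Suc by (simp only: of_nat_Suc mult_ac add_ac)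
  have regular: "(?D f)\<^sup>2 * L (f ` {..<d}) = ?R f" if "f \<in> ?F" "?D f \<noteq> 0" for f
    unfolding L_def by (rule det_sq_mult_loss_subproblem[OF X y that])
  \<comment> \<open>A singular selection contributes 0 on the left whatever its loss, while the
    right side is a sum of squares. Only here can equality be lost.\<close>
  have "(?D f)\<^sup>2 * L (f ` {..<d}) \<le> ?R f" if "f \<in> ?F" for f
  proof (cases "?D f = 0")
    case True
    have "0 \<le> ?R f" by (rule sum_nonneg) (rule zero_le_power2)
    then show ?thesis unfolding True by simp
  next
    case False
    show ?thesis unfolding regular[OF that False] by (rule order_refl)
  qed
  then have "(\<Sum>f\<in>?F. (?D f)\<^sup>2 * L (f ` {..<d})) \<le> (\<Sum>f\<in>?F. ?R f)"
    by (rule sum_mono)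
  then have "fact d * gram_det X * E \<le>
      fact d * gram_det X * ((real d + 1) * square_loss X y (lsq_solution X y))"
    unfolding lhs rhs .
  then have le: "E \<le> (real d + 1) * square_loss X y (lsq_solution X y)"
    by (rule mult_left_le_imp_le) (rule mult_pos_pos[OF fact_gt_zero pos])
  have eq: "E = (real d + 1) * square_loss X y (lsq_solution X y)" if gp: "general_position X"
  proof -
    have "(?D f)\<^sup>2 * L (f ` {..<d}) = ?R f" if f: "f \<in> ?F" for f
    proof (cases "inj_on f {..<d}")
      case True
      have im: "f ` {..<d} \<subseteq> {..<n}" using f by auto
      have "gram_det (row_submatrix X (f ` {..<d})) > 0"
        using gp im card_image[OF True] carrier_matD[OF X] unfolding general_position_def by simp
      then have "?D f \<noteq> 0" unfolding gram_det_row_submatrix[OF X True im] by simp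
      then show ?thesis by (rule regular[OF f])
    next
      case False
      \<comment> \<open>General position concerns \<open>d\<close>-sets and says nothing about a
        non-injective \<open>f\<close>. Such an \<open>f\<close> stays non-injective after a row is
        appended, so both sides are 0.\<close>
      have "\<not> inj_on (f(d := s)) {..<Suc d}" for s
      proof
        assume "inj_on (f(d := s)) {..<Suc d}"
        then have "inj_on (f(d := s)) {..<d}" by (rule inj_on_subset) auto
        also have "inj_on (f(d := s)) {..<d} \<longleftrightarrow> inj_on f {..<d}" by (rule inj_on_cong) auto
        finally show False using False by simp
      qed
      then have "Determinant.det (select_rows (Suc d) (f(d := s)) (augment_col X y)) = 0" for s
        by (rule det_select_rows_not_inj[OF augment_col_carrier[OF X]])
      then show ?thesis unfolding det_select_rows_not_inj[OF X False] by simp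
    qed
    then have "fact d * gram_det X * E =
        fact d * gram_det X * ((real d + 1) * square_loss X y (lsq_solution X y))"
      unfolding lhs rhs[symmetric] by (rule sum.cong[OF refl])
    then show ?thesis using nz by simp
  qed
  show ?thesis using le eq unfolding E_def L_def by blast
qed

end
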